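(* Let $R$ be a commutative ring with $1$ and let $f(x)=a_0+a_1x+\cdots+a_mx^m$ be a polynomial over $R$. Suppose that $R$ has an $n$-tuple $\{r_1,r_2,\dots,r_n\}$ of $f(x)$. (i) If $n>m$, then $a_i=0$ in $R$ for $0\le i\le m$. (ii) If $n=m$, then for $0\le i\le n-1$, $$a_i=(-1)^{n-i}a_n\sum_{1\le k_1<k_2<\cdots<k_{n-i}\le n} r_{k_1}r_{k_2}\cdots r_{k_{n-i}}\quad\text{in } R,$$ and hence $f(x)=a_n\prod_{i=1}^n (x-r_i)$. (iii) If $n\le m$, then for $0\le i\le n-1$, $$a_i=\frac{\det(\alpha_0,\dots,\alpha_{i-1},\beta,\alpha_{i+1},\dots,\alpha_{n-1})}{\det(\alpha_0,\alpha_1,\dots,\alpha_{n-1})}\quad\text{in } R,$$ where $\alpha_i$ denotes the column vector $(r_1^i,r_2^i,\dots,r_n^i)^T$ over $R$ for $0\le i\le n-1$, and $\beta$ denotes the column vector $\bigl(-\sum_{i=n}^m a_ir_1^i,\,-\sum_{i=n}^m a_ir_2^i,\dots,-\sum_{i=n}^m a_ir_n^i\bigr)^T$ over $R$.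
   Context: An $n$-tuple of $f(x)$ in $R$ is a subset $\{r_1,\dots,r_n\}$ of $R$ such that $f(r_i)=0$ for all $i$ and, for all $1\le i\ne j\le n$, $r_i-r_j$ is neither zero nor a zero-divisor in $R$. Meaning of fractions: if $d\in R$ is neither zero nor a zero-divisor, $t\in R$ is divisible by $d$ if there is $t'\in R$ with $t=dt'$; such $t'$ is unique and is denoted $t/d$. The identity in (iii) includes the assertion that the numerator is divisible by the denominator $\det(\alpha_0,\dots,\alpha_{n-1})$ (which is neither zero nor a zero-divisor). *)

theory Defs
  imports "Jordan_Normal_Form.Determinant"
begin

definition zero_divisor :: "'a::comm_ring_1 \<Rightarrow> bool" where
  "zero_divisor d \<longleftrightarrow> d \<noteq> 0 \<and> (\<exists>b. b \<noteq> 0 \<and> d * b = 0)"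

definition regular :: "'a::comm_ring_1 \<Rightarrow> bool" where
  "regular d \<longleftrightarrow> d \<noteq> 0 \<and> \<not> zero_divisor d"

text \<open>An n-tuple of f is presented through an enumeration r 1, ..., r n of its elements;
  values of r outside {1..n} are irrelevant. The elements are automatically pairwise distinct,
  since 0 is not regular.\<close>

definition root_tuple :: "'a::comm_ring_1 poly \<Rightarrow> nat \<Rightarrow> (nat \<Rightarrow> 'a) \<Rightarrow> bool" where
  "root_tuple f n r \<longleftrightarrow>
     (\<forall>i\<in>{1..n}. poly f (r i) = 0) \<and>
     (\<forall>i\<in>{1..n}. \<forall>j\<in>{1..n}. i \<noteq> j \<longrightarrow> regular (r i - r j))"

text \<open>The quotient t / d. It is meaningful only if d is regular and divides t,
  in which case the described element exists and is unique.\<close>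

definition quot :: "'a::comm_ring_1 \<Rightarrow> 'a \<Rightarrow> 'a" where
  "quot t d = (THE t'. t = d * t')"

text \<open>Vector entries are indexed from 0, hence the shift in the argument of r.\<close>

definition alpha :: "nat \<Rightarrow> (nat \<Rightarrow> 'a::comm_ring_1) \<Rightarrow> nat \<Rightarrow> 'a vec" where
  "alpha n r i = vec n (\<lambda>k. r (Suc k) ^ i)"

definition beta :: "nat \<Rightarrow> nat \<Rightarrow> (nat \<Rightarrow> 'a::comm_ring_1) \<Rightarrow> (nat \<Rightarrow> 'a) \<Rightarrow> 'a vec" where
  "beta n m a r = vec n (\<lambda>k. - (\<Sum>i=n..m. a i * r (Suc k) ^ i))"

definition det_cols :: "nat \<Rightarrow> 'a::comm_ring_1 vec list \<Rightarrow> 'a" where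
  "det_cols n cs = det (mat_of_cols n cs)"

end

theory Submission
  imports Defs
begin

text \<open>
Everything rests on one observation: an element that is neither zero nor a zero divisor can be
cancelled, and such elements are closed under products. Cancellation of the differences
\<open>r i - r j\<close> replaces, over an arbitrary commutative ring, the integral domain argument that each
further root of \<open>f\<close> is a root of the cofactor left by the roots already split off. Hence the
product of all \<open>x - r i\<close> divides \<open>f\<close> (lemma \<open>linear_prod_dvd\<close>). This product is monic of
degree \<open>n\<close>, so if \<open>f\<close> has degree at most \<open>n\<close> the cofactor is a constant, namely the
coefficient of \<open>f\<close> at \<open>n\<close>. For \<open>n > m\<close> that coefficient is \<open>0\<close>, and \<open>f\<close> vanishes; for
\<open>n = m\<close> it is \<open>a n\<close>, and expanding the product gives Vieta's formulas.

For \<open>n \<le> m\<close>, the equations \<open>f (r k) = 0\<close> form a linear system whose matrix is the Vandermonde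
matrix \<open>V\<close>, whose unknowns are the lower coefficients \<open>a 0, \<dots>, a (n - 1)\<close>, and whose right-hand
side is \<open>\<beta>\<close>. Cramer's rule in the form \<open>det V * a i = det (V with column i replaced by \<beta>)\<close>
holds over every commutative ring, so it remains to see that \<open>det V\<close> can be cancelled. The
closed formula for the Vandermonde determinant can be bypassed: multiplying \<open>V\<close> by the matrix of
coefficients of the unnormalised Lagrange polynomials gives a diagonal matrix whose entries are
products of differences \<open>r i - r j\<close>, so \<open>det V\<close> divides a regular element and is itself regular
(lemma \<open>regular_vandermonde_det\<close>).
\<close>

section \<open>Regular elements\<close>

text \<open>Cancellability already forces \<open>d \<noteq> 0\<close>, since \<open>0 * 1 = 0\<close> while \<open>1 \<noteq> 0\<close>.\<close>

lemma regular_iff_cancel: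
  fixes d :: "'a::comm_ring_1"
  shows "regular d \<longleftrightarrow> (\<forall>b. d * b = 0 \<longrightarrow> b = 0)"
proof
  assume "regular d"
  then show "\<forall>b. d * b = 0 \<longrightarrow> b = 0"
    unfolding regular_def zero_divisor_def by blast
next
  assume cancel: "\<forall>b. d * b = 0 \<longrightarrow> b = 0"
  have "d * 1 = 0 \<longrightarrow> (1::'a) = 0"
    using cancel by (rule spec)
  then have "d \<noteq> 0" by simp
  with cancel show "regular d"
    unfolding regular_def zero_divisor_def by blast
qed

lemma regular_cancel: "regular d \<Longrightarrow> d * b = 0 \<Longrightarrow> b = 0"
  unfolding regular_iff_cancel by blast

lemma regular_mult:
  assumes "regular a" "regular b"
  shows "regular (a * b)"
  unfolding regular_iff_cancel
proof (intro allI impI)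
  fix c assume "a * b * c = 0"
  then have "a * (b * c) = 0"
    by (simp add: mult.assoc)
  then have "b * c = 0"
    by (rule regular_cancel[OF assms(1)])
  then show "c = 0"
    by (rule regular_cancel[OF assms(2)])
qed

lemma regular_one: "regular 1"
  unfolding regular_iff_cancel by simp

lemma regular_prod: "(\<And>i. i \<in> A \<Longrightarrow> regular (g i)) \<Longrightarrow> regular (\<Prod>i\<in>A. g i)"
  by (induction A rule: infinite_finite_induct)
    (simp_all add: regular_one regular_mult)

lemma regular_left_factor:
  assumes "regular (a * b)"
  shows "regular a"
  unfolding regular_iff_cancel
proof (intro allI impI)
  fix c assume "a * c = 0"
  then have "(a * b) * c = 0"
    by (metis mult.commute mult.left_commute mult_zero_right)
  then show "c = 0"
    by (rule regular_cancel[OF assms])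
qed

lemma quot_regular_mult:
  assumes "regular d"
  shows "quot (d * x) d = x"
  unfolding quot_def
proof (rule the_equality)
  fix y assume "d * x = d * y"
  then have "d * (x - y) = 0"
    by (simp add: algebra_simps)
  then have "x - y = 0"
    by (rule regular_cancel[OF assms])
  then show "y = x" by simp
qed simp

section \<open>Splitting off linear factors\<close>

text \<open>Evaluating \<open>f\<close> at a new root \<open>r x\<close> gives \<open>\<Prod>i\<in>A. r x - r i\<close> times the value of the
cofactor at \<open>r x\<close>. The first factor is regular, so \<open>r x\<close> is a root of the cofactor.\<close>

lemma linear_prod_dvd:
  fixes f :: "'a::comm_ring_1 poly"
  assumes "finite A"
    and "\<And>i. i \<in> A \<Longrightarrow> poly f (r i) = 0"
    and "\<And>i j. i \<in> A \<Longrightarrow> j \<in> A \<Longrightarrow> i \<noteq> j \<Longrightarrow> regular (r i - r j)"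
  shows "(\<Prod>i\<in>A. [:- r i, 1:]) dvd f"
  using assms
proof (induction A rule: finite_induct)
  case (insert x A)
  have "(\<Prod>i\<in>A. [:- r i, 1:]) dvd f"
    by (rule insert.IH) (simp_all add: insert.prems)
  then obtain q where q: "f = (\<Prod>i\<in>A. [:- r i, 1:]) * q"
    by (elim dvdE)
  have "regular (\<Prod>i\<in>A. r x - r i)"
    using insert.prems(2) insert.hyps(2) by (intro regular_prod) auto
  moreover have "(\<Prod>i\<in>A. r x - r i) * poly q (r x) = 0"
    using insert.prems(1)[of x] by (simp add: q poly_prod)
  ultimately have "poly q (r x) = 0"
    by (rule regular_cancel)
  then have "[:- r x, 1:] dvd q"
    by (simp add: poly_eq_0_iff_dvd)
  then show ?case
    unfolding q prod.insert[OF insert.hyps] mult.commute[of "[:- r x, 1:]"]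
    by (rule mult_dvd_mono[OF dvd_refl])
qed simp

text \<open>Vieta's formulas: in the expansion over subsets \<open>X\<close> of \<open>A\<close>, where \<open>X\<close> records the
factors that contribute their constant term, the summand of \<open>X\<close> is a monomial of degree
\<open>card A - card X\<close>.\<close>

lemma coeff_linear_prod:
  fixes r :: "'b \<Rightarrow> 'a::comm_ring_1"
  assumes "finite A" "i \<le> card A"
  shows "coeff (\<Prod>k\<in>A. [:- r k, 1:]) i =
    (-1) ^ (card A - i) * (\<Sum>K | K \<subseteq> A \<and> card K = card A - i. \<Prod>k\<in>K. r k)"
proof -
  have const: "(\<Prod>k\<in>X. [:r k:]) = [:\<Prod>k\<in>X. r k:]" for X
    by (induction X rule: infinite_finite_induct) (auto simp: one_pCons)
  have "(\<Prod>k\<in>A. [:- r k, 1:]) = (\<Prod>k\<in>A. monom 1 1 - [:r k:])"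
    by (intro prod.cong) (auto simp: monom_altdef)
  also have "\<dots> = (\<Sum>X\<in>Pow A. (-1) ^ card X * (\<Prod>k\<in>X. [:r k:]) * (\<Prod>k\<in>A - X. monom 1 1))"
    by (rule prod_diff_conv_sum[OF assms(1)])
  also have "\<dots> = (\<Sum>X\<in>Pow A. monom ((-1) ^ card X * (\<Prod>k\<in>X. r k)) (card A - card X))"
  proof (intro sum.cong refl)
    fix X assume "X \<in> Pow A"
    then have "card (A - X) = card A - card X"
      using assms(1) by (auto intro: card_Diff_subset finite_subset)
    moreover have "(-1) ^ c = [:(-1::'a) ^ c:]" for c
      by (induction c) (auto simp: one_pCons)
    ultimately show "(-1) ^ card X * (\<Prod>k\<in>X. [:r k:]) * (\<Prod>k\<in>A - X. monom 1 1) =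
        monom ((-1) ^ card X * (\<Prod>k\<in>X. r k)) (card A - card X)"
      by (simp add: const monom_power smult_monom mult.commute)
  qed
  finally have "coeff (\<Prod>k\<in>A. [:- r k, 1:]) i =
      (\<Sum>X\<in>Pow A. if card A - card X = i then (-1) ^ card X * (\<Prod>k\<in>X. r k) else 0)"
    by (simp add: coeff_sum)
  also have "\<dots> = (\<Sum>X\<in>{K. K \<subseteq> A \<and> card K = card A - i}. (-1) ^ card X * (\<Prod>k\<in>X. r k))"
  proof -
    have "{X \<in> Pow A. card A - card X = i} = {K. K \<subseteq> A \<and> card K = card A - i}"
      using assms card_mono[OF assms(1)] by fastforce
    then show ?thesis
      using assms(1) by (simp add: sum.inter_filter[symmetric])
  qed
  finally show ?thesis
    by (simp add: sum_distrib_left)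
qed

lemma monic_linear_prod:
  fixes r :: "'b \<Rightarrow> 'a::comm_ring_1"
  assumes "finite A"
  shows "degree (\<Prod>k\<in>A. [:- r k, 1:]) = card A" "coeff (\<Prod>k\<in>A. [:- r k, 1:]) (card A) = 1"
proof -
  let ?P = "\<Prod>k\<in>A. [:- r k, 1:]"
  have "{K. K \<subseteq> A \<and> card K = 0} = {{}}"
    using assms by (auto dest: finite_subset)
  then show lead: "coeff ?P (card A) = 1"
    by (simp add: coeff_linear_prod[OF assms])
  have "degree ?P \<le> card A"
    using degree_prod_sum_le[OF assms, of "\<lambda>k. [:- r k, 1:]"] by simp
  moreover have "card A \<le> degree ?P"
    by (rule le_degree) (simp add: lead)
  ultimately show "degree ?P = card A" by simp
qed

text \<open>Because the product is monic, degrees add up in \<open>f = (\<Prod>k\<in>A. [:- r k, 1:]) * q\<close> even in the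
presence of zero divisors, which forces \<open>q\<close> to be constant.\<close>

lemma smult_linear_prod_if_degree_le:
  fixes f :: "'a::comm_ring_1 poly"
  assumes "finite A" "(\<Prod>k\<in>A. [:- r k, 1:]) dvd f" "degree f \<le> card A"
  shows "f = smult (coeff f (card A)) (\<Prod>k\<in>A. [:- r k, 1:])"
proof -
  let ?P = "\<Prod>k\<in>A. [:- r k, 1:]"
  obtain q where q: "f = ?P * q"
    using assms(2) by (elim dvdE)
  have "coeff f (card A + degree q) = lead_coeff q"
    using coeff_mult_degree_sum[of ?P q] monic_linear_prod[OF assms(1), of r] by (simp add: q)
  then have "degree q = 0"
    using le_degree[of f "card A + degree q"] assms(3) by (cases "q = 0") auto
  then obtain c where "q = [:c:]"
    by (elim degree_eq_zeroE)
  then show ?thesis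
    using monic_linear_prod(2)[OF assms(1), of r] by (simp add: q)
qed

section \<open>The Vandermonde determinant\<close>

text \<open>The matrix \<open>C\<close> collects, as columns, the coefficients of the Lagrange polynomials
\<open>L j = (\<Prod>k \<noteq> j. X - x k)\<close>. Multiplication by \<open>V\<close> evaluates them at the nodes, and \<open>L j\<close> vanishes
at every node except \<open>x j\<close>. So \<open>det V * det C\<close> is the product of all \<open>x k - x i\<close> with
\<open>k \<noteq> i\<close>, and a factor of a regular element is regular.\<close>

lemma regular_vandermonde_det:
  fixes x :: "nat \<Rightarrow> 'a::comm_ring_1"
  assumes "\<And>i j. i < n \<Longrightarrow> j < n \<Longrightarrow> i \<noteq> j \<Longrightarrow> regular (x i - x j)"
  shows "regular (det (mat n n (\<lambda>(k, i). x k ^ i)))"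
proof -
  define L where "L j = (\<Prod>k\<in>{..<n} - {j}. [:- x k, 1:])" for j
  define V where "V = mat n n (\<lambda>(k, i). x k ^ i)"
  define C where "C = mat n n (\<lambda>(i, j). coeff (L j) i)"
  have VC: "(V * C) $$ (k, j) = poly (L j) (x k)" if "k < n" "j < n" for k j
  proof -
    have "degree (L j) = n - 1"
      using monic_linear_prod(1)[of "{..<n} - {j}" x] that by (simp add: L_def)
    with that have "{..degree (L j)} = {0..<n}"
      by auto
    with that show ?thesis
      by (simp add: V_def C_def scalar_prod_def poly_altdef mult.commute)
  qed
  have eval: "poly (L j) (x k) = (\<Prod>i\<in>{..<n} - {j}. x k - x i)" for j k
    by (simp add: L_def poly_prod)
  have carr: "V \<in> carrier_mat n n" "C \<in> carrier_mat n n" "V * C \<in> carrier_mat n n"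
    by (auto simp: V_def C_def)
  \<comment> \<open>The product is even diagonal; triangularity is what the determinant rule asks for.\<close>
  have "upper_triangular (V * C)"
  proof
    fix i j assume "j < i" "i < dim_row (V * C)"
    then have *: "i < n" "j < n" "i \<in> {..<n} - {j}"
      by (auto simp: V_def)
    have "(\<Prod>k\<in>{..<n} - {j}. x i - x k) = 0"
      using *(3) by (intro prod_zero) auto
    then show "(V * C) $$ (i, j) = 0"
      using VC[OF *(1,2)] eval by (simp del: index_mult_mat)
  qed
  then have "det (V * C) = (\<Prod>k = 0..<n. (V * C) $$ (k, k))"
    unfolding det_upper_triangular[OF \<open>upper_triangular (V * C)\<close> carr(3)] prod_list_diag_prod
    by (simp add: V_def del: index_mult_mat(1))
  also have "\<dots> = (\<Prod>k = 0..<n. \<Prod>i\<in>{..<n} - {k}. x k - x i)"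
    by (intro prod.cong refl) (simp add: VC eval del: index_mult_mat(1))
  also have "regular \<dots>"
    using assms by (intro regular_prod) auto
  finally have "regular (det V * det C)"
    using carr by (simp add: det_mult)
  then show ?thesis
    unfolding V_def by (rule regular_left_factor)
qed

section \<open>Polynomials with a tuple of roots\<close>

theorem theorem1p8:
  fixes a r :: "nat \<Rightarrow> 'a::comm_ring_1" and f :: "'a poly" and m n :: nat
  assumes "f = (\<Sum>i=0..m. monom (a i) i)"
    and "root_tuple f n r"
  shows "(n > m \<longrightarrow> (\<forall>i\<le>m. a i = 0)) \<and>
    (n = m \<longrightarrow>
       (\<forall>i<n. a i = (-1) ^ (n - i) * a n *
          (\<Sum>K | K \<subseteq> {1..n} \<and> card K = n - i. \<Prod>k\<in>K. r k)) \<and>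
       f = smult (a n) (\<Prod>i=1..n. [:- r i, 1:])) \<and>
    (n \<le> m \<longrightarrow>
       (let cols = map (alpha n r) [0..<n]; D = det_cols n cols
        in regular D \<and>
           (\<forall>i<n. let N = det_cols n (cols[i := beta n m a r])
                  in D dvd N \<and> a i = quot N D)))"
proof -
  let ?P = "\<Prod>i=1..n. [:- r i, 1:]"
  have root: "poly f (r i) = 0" if "i \<in> {1..n}" for i
    using assms(2) that by (simp add: root_tuple_def)
  have reg: "regular (r i - r j)" if "i \<in> {1..n}" "j \<in> {1..n}" "i \<noteq> j" for i j
    using assms(2) that by (simp add: root_tuple_def)
  have coeff_f: "coeff f i = (if i \<le> m then a i else 0)" for i
    by (simp add: assms(1) coeff_sum)
  have poly_f: "poly f x = (\<Sum>i=0..m. a i * x ^ i)" for x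
    by (simp add: assms(1) poly_sum poly_monom)
  have "degree f \<le> m"
    by (simp add: coeff_f degree_le)
  then have factored: "f = smult (coeff f n) ?P" if "m \<le> n"
    using smult_linear_prod_if_degree_le[of "{1..n}" r f] linear_prod_dvd[of "{1..n}" f r]
      root reg that by auto

  have "\<forall>i\<le>m. a i = 0" if "n > m"
  proof -
    have "f = 0"
      using factored that by (simp add: coeff_f)
    then show ?thesis
      using coeff_f by (metis coeff_0)
  qed
  moreover have "(\<forall>i<n. a i = (-1) ^ (n - i) * a n *
          (\<Sum>K | K \<subseteq> {1..n} \<and> card K = n - i. \<Prod>k\<in>K. r k)) \<and> f = smult (a n) ?P"
    if "n = m"
  proof -
    have f: "f = smult (a n) ?P"
      using factored that by (simp add: coeff_f)
    have "a i = (-1) ^ (n - i) * a n *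
          (\<Sum>K | K \<subseteq> {1..n} \<and> card K = n - i. \<Prod>k\<in>K. r k)" if "i < n" for i
    proof -
      have "a i = coeff (smult (a n) ?P) i"
        using coeff_f[of i] \<open>n = m\<close> that f by simp
      then show ?thesis
        using coeff_linear_prod[of "{1..n}" i r] that by (simp add: ac_simps)
    qed
    with f show ?thesis by blast
  qed
  moreover have "let cols = map (alpha n r) [0..<n]; D = det_cols n cols
        in regular D \<and>
           (\<forall>i<n. let N = det_cols n (cols[i := beta n m a r])
                  in D dvd N \<and> a i = quot N D)"
    if "n \<le> m"
  proof -
    define cols where "cols = map (alpha n r) [0..<n]"
    define V where "V = mat_of_cols n cols"
    have V: "V = mat n n (\<lambda>(k, i). r (Suc k) ^ i)"
      by (auto simp: V_def cols_def mat_of_cols_def alpha_def)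
    have regular_D: "regular (det V)"
      unfolding V by (rule regular_vandermonde_det) (auto intro: reg)
    \<comment> \<open>Row \<open>k\<close> is the equation \<open>f (r (k + 1)) = 0\<close> with the terms of degree at least \<open>n\<close> moved to the right.\<close>
    have beta: "V *\<^sub>v vec n a = beta n m a r"
    proof (rule eq_vecI)
      fix k assume "k < dim_vec (beta n m a r)"
      then have "k < n" by (simp add: beta_def)
      have "(\<Sum>i=0..<n. a i * r (Suc k) ^ i) + (\<Sum>i=n..m. a i * r (Suc k) ^ i) = 0"
      proof -
        have "{0..m} = {0..<n} \<union> {n..m}" "{0..<n} \<inter> {n..m} = {}"
          using that by auto
        then show ?thesis
          using root[of "Suc k"] \<open>k < n\<close> by (simp add: poly_f sum.union_disjoint)
      qed
      then have "(\<Sum>i=0..<n. a i * r (Suc k) ^ i) = - (\<Sum>i=n..m. a i * r (Suc k) ^ i)"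
        by (rule add_eq_0_iff2[THEN iffD1])
      then show "(V *\<^sub>v vec n a) $ k = beta n m a r $ k"
        using \<open>k < n\<close> by (simp add: V beta_def scalar_prod_def mult.commute)
    qed (simp add: V beta_def)
    have N: "det_cols n (cols[i := beta n m a r]) = det V * a i" if "i < n" for i
    proof -
      have "mat_of_cols n (cols[i := beta n m a r]) = replace_col V (V *\<^sub>v vec n a) i"
        unfolding beta
        by (auto simp: replace_col_def V mat_of_cols_def cols_def alpha_def nth_list_update)
      then show ?thesis
        using cramer_lemma_mat[of V n "vec n a" i] that
        by (simp add: det_cols_def V mult.commute)
    qed
    show ?thesis
      unfolding cols_def[symmetric] Let_def
      using regular_D N by (simp add: det_cols_def[of n cols] V_def[symmetric] quot_regular_mult)
  qed
  ultimately show ?thesis by blast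
qed

end
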